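(* Let $C\in\mathcal H^n$, $A_1,\dots,A_m\in\mathbb H^{n\times n}$, $b\in\mathbb H^m$, and consider the quaternionic semidefinite program (QSDP-$\mathbb H$) and the two real semidefinite programs (QSDP-$\mathbb R$) and (QSDP-$\mathbb R'$) built from these data as described in the context. Then (QSDP-$\mathbb R'$) and (QSDP-$\mathbb R$) have the same optimal value. Moreover, if $X^\star$ is an optimal solution of (QSDP-$\mathbb R'$), then $$H^\star=R_{X^\star}+I_{X^\star}\mathbf i+J_{X^\star}\mathbf j+K_{X^\star}\mathbf k$$ is an optimal solution of (QSDP-$\mathbb H$).
   Context: $\mathbb H$ is the skew field of quaternions with units $\mathbf i,\mathbf j,\mathbf k$ ($\mathbf i^2=\mathbf j^2=\mathbf k^2=\mathbf i\mathbf j\mathbf k=-1$). A quaternionic matrix is written $A=A_R+A_I\mathbf i+A_J\mathbf j+A_K\mathbf k$ with real matrices $A_R,A_I,A_J,A_K$; $A^*$ is the conjugate transpose; $\mathcal R(\cdot)$ is the real part; $\mathcal H^n$ is the space of Hermitian matrices ($A=A^*$) in $\mathbb H^{n\times n}$; $A\in\mathcal H^n$ is positive semidefinite ($A\succeq0$) if $\mathbf v^*A\mathbf v\ge0$ for all $\mathbf v\in\mathbb H^n$. $\mathcal S^{N}$ is the space of real symmetric $N\times N$ matrices. $\langle A,B\rangle=\mathrm{Tr}(A^*B)$ (for real matrices, $\mathrm{Tr}(A^{\intercal}B)$). (QSDP-$\mathbb H$): maximize (sup) $\mathcal R(\langle C,H\rangle)$ over $H\in\mathcal H^n$ subject to $\langle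 A_i,H\rangle=b_i$ for $i=1,\dots,m$, and $H\succeq0$. Write $H=H_R+H_I\mathbf i+H_J\mathbf j+H_K\mathbf k$, $C=C_R+C_I\mathbf i+C_J\mathbf j+C_K\mathbf k$, $A_i=(A_i)_R+(A_i)_I\mathbf i+(A_i)_J\mathbf j+(A_i)_K\mathbf k$, $b=b_R+b_I\mathbf i+b_J\mathbf j+b_K\mathbf k$. For $T\in\{R,I,J,K\}$ define $\mathscr A_T:\mathbb R^{n\times n}\to\mathbb R^m$ by $\mathscr A_T(S)=(\langle (A_i)_T,S\rangle)_{i=1}^m$. Put $$\Lambda(H)=\begin{bmatrix} H_R&-H_I&-H_J&-H_K \\ H_I&H_R&-H_K&H_J \\ H_J&H_K&H_R&-H_I \\ H_K&-H_J&H_I&H_R \end{bmatrix}.$$ (QSDP-$\mathbb R$): maximize $\langle C_R,H_R\rangle+\langle C_I,H_I\rangle+\langle C_J,H_J\rangle+\langle C_K,H_K\rangle$ over $Y\in\mathcal S^{4n}$ having the block form $Y=\Lambda(H)$ (with real $n\times n$ blocks $H_R,H_I,H_J,H_K$), $Y\succeq0$, subject to $$\begin{aligned} &\mathscr A_R(H_R)+\mathscr A_I(H_I)+\mathscr A_J(H_J)+\mathscr A_K(H_K)=b_R, \\ &\mathscr A_R(H_I)-\mathscr A_I(H_R)-\mathscr A_J(H_K)+\mathscr A_K(H_J)=b_I, \\ &\mathscr A_R(H_J)+\mathscr A_I(H_K)-\mathscr A_J(H_R)-\mathscr A_K(H_I)=b_J, \\ &\mathscr A_R(H_K)-\mathscr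 A_I(H_J)+\mathscr A_J(H_I)-\mathscr A_K(H_R)=b_K. \end{aligned}$$ For $X\in\mathcal S^{4n}$ with $n\times n$ blocks $$X=\begin{bmatrix} X_1&X_5^{\intercal}&X_6^{\intercal}&X_7^{\intercal} \\ X_5&X_2&X_8^{\intercal}&X_9^{\intercal} \\ X_6&X_8&X_3&X_{10}^{\intercal} \\ X_7&X_9&X_{10}&X_4 \end{bmatrix}$$ put $R_X=X_1+X_2+X_3+X_4$, $I_X=X_5-X_5^{\intercal}+X_{10}-X_{10}^{\intercal}$, $J_X=X_6-X_6^{\intercal}-X_9+X_9^{\intercal}$, $K_X=X_7-X_7^{\intercal}+X_8-X_8^{\intercal}$. (QSDP-$\mathbb R'$): maximize $\langle C_R,R_X\rangle+\langle C_I,I_X\rangle+\langle C_J,J_X\rangle+\langle C_K,K_X\rangle$ over $X\in\mathcal S^{4n}$, $X\succeq0$, subject to the same four linear equations as in (QSDP-$\mathbb R$) with $(H_R,H_I,H_J,H_K)$ replaced by $(R_X,I_X,J_X,K_X)$. *)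

theory Defs
  imports "HOL-Analysis.Analysis"
begin

section \<open>Quaternions\<close>

datatype quat = Quat (qR: real) (qI: real) (qJ: real) (qK: real)

lemma quat_eq_iff: "x = y \<longleftrightarrow> qR x = qR y \<and> qI x = qI y \<and> qJ x = qJ y \<and> qK x = qK y"
  by (auto intro: quat.expand)

instantiation quat :: real_div_algebra
begin

definition "0 = Quat 0 0 0 0"
definition "1 = Quat 1 0 0 0"
definition "x + y = Quat (qR x + qR y) (qI x + qI y) (qJ x + qJ y) (qK x + qK y)"
definition "x - y = Quat (qR x - qR y) (qI x - qI y) (qJ x - qJ y) (qK x - qK y)"
definition "- x = Quat (- qR x) (- qI x) (- qJ x) (- qK x)"
definition "x * y = Quat
  (qR x * qR y - qI x * qI y - qJ x * qJ y - qK x * qK y)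
  (qR x * qI y + qI x * qR y + qJ x * qK y - qK x * qJ y)
  (qR x * qJ y - qI x * qK y + qJ x * qR y + qK x * qI y)
  (qR x * qK y + qI x * qJ y - qJ x * qI y + qK x * qR y)"
definition "r *\<^sub>R x = Quat (r * qR x) (r * qI x) (r * qJ x) (r * qK x)"
definition "inverse x =
  (let N = (qR x)\<^sup>2 + (qI x)\<^sup>2 + (qJ x)\<^sup>2 + (qK x)\<^sup>2
   in Quat (qR x / N) (- qI x / N) (- qJ x / N) (- qK x / N))"
definition "(x :: quat) div y = x * inverse y"

lemmas quat_defs = zero_quat_def one_quat_def plus_quat_def minus_quat_def uminus_quat_def
  times_quat_def scaleR_quat_def inverse_quat_def divide_quat_def

lemma quat_norm_nonzero:
  "x \<noteq> 0 \<Longrightarrow> (qR x)\<^sup>2 + (qI x)\<^sup>2 + (qJ x)\<^sup>2 + (qK x)\<^sup>2 \<noteq> 0"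
  by (auto simp: quat_eq_iff zero_quat_def add_nonneg_eq_0_iff)

instance
proof
  fix x :: quat
  assume "x \<noteq> 0"
  note N = quat_norm_nonzero [OF this]
  define N' where "N' = (qR x)\<^sup>2 + (qI x)\<^sup>2 + (qJ x)\<^sup>2 + (qK x)\<^sup>2"
  have inv: "inverse x = Quat (qR x / N') (- qI x / N') (- qJ x / N') (- qK x / N')"
    by (simp add: inverse_quat_def N'_def Let_def)
  have one: "(qR x * qR x + qI x * qI x + qJ x * qJ x + qK x * qK x) / N' = 1"
    using N by (simp add: N'_def power2_eq_square)
  show "inverse x * x = 1"
    using one
    by (simp add: inv times_quat_def one_quat_def add_divide_distrib mult.commute)
  show "x * inverse x = 1"
    using one
    by (simp add: inv times_quat_def one_quat_def add_divide_distrib mult.commute)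
qed (simp_all add: quat_defs algebra_simps)

end

definition qi :: quat where "qi = Quat 0 1 0 0"
definition qj :: quat where "qj = Quat 0 0 1 0"
definition qk :: quat where "qk = Quat 0 0 0 1"

lemma quat_units: "qi * qi = -1" "qj * qj = -1" "qk * qk = -1" "qi * qj * qk = -1"
  by (simp_all add: qi_def qj_def qk_def quat_defs)

lemma Quat_eq: "Quat a b c d = of_real a + of_real b * qi + of_real c * qj + of_real d * qk"
  by (simp add: qi_def qj_def qk_def of_real_def quat_defs)

definition qcnj :: "quat \<Rightarrow> quat" where
  "qcnj x = Quat (qR x) (- qI x) (- qJ x) (- qK x)"

section \<open>Matrices\<close>

definition ctranspose :: "quat^'n^'m \<Rightarrow> quat^'m^'n" where
  "ctranspose A = transpose (map_matrix qcnj A)"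

definition qinner :: "quat^'n^'n \<Rightarrow> quat^'n^'n \<Rightarrow> quat" where
  "qinner A B = trace (ctranspose A ** B)"

definition rinner :: "real^'n^'n \<Rightarrow> real^'n^'n \<Rightarrow> real" where
  "rinner A B = trace (transpose A ** B)"

definition hermitian :: "quat^'n^'n \<Rightarrow> bool" where
  "hermitian A \<longleftrightarrow> A = ctranspose A"

text \<open>The inequality \<open>v\<^sup>* A v \<ge> 0\<close> says that this quaternion is a nonnegative real.\<close>

definition qpsd :: "quat^'n^'n \<Rightarrow> bool" where
  "qpsd A \<longleftrightarrow> hermitian A \<and>
     (\<forall>v. \<exists>r\<ge>0. (\<Sum>i\<in>UNIV. qcnj (v $ i) * (A *v v) $ i) = of_real r)"

definition symmetric :: "real^'n^'n \<Rightarrow> bool" where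
  "symmetric A \<longleftrightarrow> A = transpose A"

definition rpsd :: "real^'n^'n \<Rightarrow> bool" where
  "rpsd A \<longleftrightarrow> symmetric A \<and> (\<forall>v. v \<bullet> (A *v v) \<ge> 0)"

definition quat_mat :: "real^'n^'n \<Rightarrow> real^'n^'n \<Rightarrow> real^'n^'n \<Rightarrow> real^'n^'n \<Rightarrow> quat^'n^'n" where
  "quat_mat R I J K = (\<chi> i j. Quat (R $ i $ j) (I $ i $ j) (J $ i $ j) (K $ i $ j))"

lemma quat_mat_components [simp]:
  "quat_mat (map_matrix qR A) (map_matrix qI A) (map_matrix qJ A) (map_matrix qK A) = A"
  by (simp add: quat_mat_def vec_eq_iff)

text \<open>
  Real \<open>4n \<times> 4n\<close> matrices are indexed by \<open>4 \<times> 'n\<close>, the first component selecting the block.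
  The numeral type \<open>4\<close> has the elements \<open>1, 2, 3, 4\<close> (with \<open>4 = 0\<close>), matching \<^const>\<open>vector\<close>.
\<close>

definition from_blocks :: "(real^'n^'n)^4^4 \<Rightarrow> real^(4 \<times> 'n)^(4 \<times> 'n)" where
  "from_blocks B = (\<chi> p q. B $ fst p $ fst q $ snd p $ snd q)"

definition block :: "real^(4 \<times> 'n)^(4 \<times> 'n) \<Rightarrow> 4 \<Rightarrow> 4 \<Rightarrow> real^'n^'n" where
  "block X k l = (\<chi> i j. X $ (k, i) $ (l, j))"

definition Lam :: "real^'n^'n \<Rightarrow> real^'n^'n \<Rightarrow> real^'n^'n \<Rightarrow> real^'n^'n \<Rightarrow> real^(4 \<times> 'n)^(4 \<times> 'n)" where
  "Lam R I J K = from_blocks (vector [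
     vector [R, - I, - J, - K],
     vector [I,   R, - K,   J],
     vector [J,   K,   R, - I],
     vector [K, - J,   I,   R]])"

definition RX :: "real^(4 \<times> 'n)^(4 \<times> 'n) \<Rightarrow> real^'n^'n" where
  "RX X = block X 1 1 + block X 2 2 + block X 3 3 + block X 4 4"

definition IX :: "real^(4 \<times> 'n)^(4 \<times> 'n) \<Rightarrow> real^'n^'n" where
  "IX X = block X 2 1 - transpose (block X 2 1) + block X 4 3 - transpose (block X 4 3)"

definition JX :: "real^(4 \<times> 'n)^(4 \<times> 'n) \<Rightarrow> real^'n^'n" where
  "JX X = block X 3 1 - transpose (block X 3 1) - block X 4 2 + transpose (block X 4 2)"

definition KX :: "real^(4 \<times> 'n)^(4 \<times> 'n) \<Rightarrow> real^'n^'n" where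
  "KX X = block X 4 1 - transpose (block X 4 1) + block X 3 2 - transpose (block X 3 2)"

lemma vector_4 [simp]:
  "(vector [a, b, c, d] :: 'a::zero^4) $ 1 = a"
  "(vector [a, b, c, d] :: 'a::zero^4) $ 2 = b"
  "(vector [a, b, c, d] :: 'a::zero^4) $ 3 = c"
  "(vector [a, b, c, d] :: 'a::zero^4) $ 4 = d"
  by (simp_all add: vector_def)

lemma block_Lam:
  "block (Lam R I J K) 1 1 = R" "block (Lam R I J K) 2 1 = I"
  "block (Lam R I J K) 3 1 = J" "block (Lam R I J K) 4 1 = K"
  by (simp_all add: block_def Lam_def from_blocks_def vec_eq_iff)

lemma forall_index_4: "(\<forall>k::4. P k) \<longleftrightarrow> P 1 \<and> P 2 \<and> P 3 \<and> P 4"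
  by (metis exhaust_4)

lemma symmetric_blocks:
  assumes "symmetric X"
  shows "X = from_blocks (vector [
     vector [block X 1 1, transpose (block X 2 1), transpose (block X 3 1), transpose (block X 4 1)],
     vector [block X 2 1, block X 2 2, transpose (block X 3 2), transpose (block X 4 2)],
     vector [block X 3 1, block X 3 2, block X 3 3, transpose (block X 4 3)],
     vector [block X 4 1, block X 4 2, block X 4 3, block X 4 4]])"
proof -
  have sym: "X $ q $ p = X $ p $ q" for p q
    using arg_cong [OF assms [unfolded symmetric_def], of "\<lambda>Z. Z $ p $ q"]
    by (simp add: transpose_def)
  have tr: "transpose (block X k l) = block X l k" for k l
    by (simp add: vec_eq_iff block_def transpose_def sym [of "(k, _)" "(l, _)"])
  show ?thesis
    by (simp add: vec_eq_iff from_blocks_def forall_index_4 tr)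
       (simp add: block_def)
qed

section \<open>Semidefinite programs\<close>

text \<open>
  A maximisation problem is given by its feasible set \<open>F\<close> and its objective \<open>f\<close>. Its optimal
  value is taken in the extended reals: \<open>-\<infinity>\<close> if infeasible, \<open>\<infinity>\<close> if unbounded.
\<close>

definition optimal_value :: "'a set \<Rightarrow> ('a \<Rightarrow> real) \<Rightarrow> ereal" where
  "optimal_value F f = (SUP x\<in>F. ereal (f x))"

definition optimal_solution :: "'a set \<Rightarrow> ('a \<Rightarrow> real) \<Rightarrow> 'a \<Rightarrow> bool" where
  "optimal_solution F f x \<longleftrightarrow> x \<in> F \<and> (\<forall>y\<in>F. f y \<le> f x)"

definition feasible_H :: "nat \<Rightarrow> (nat \<Rightarrow> quat^'n^'n) \<Rightarrow> (nat \<Rightarrow> quat) \<Rightarrow> (quat^'n^'n) set" where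
  "feasible_H m A b = {H. hermitian H \<and> (\<forall>i\<in>{1..m}. qinner (A i) H = b i) \<and> qpsd H}"

definition objective_H :: "quat^'n^'n \<Rightarrow> quat^'n^'n \<Rightarrow> real" where
  "objective_H C H = qR (qinner C H)"

text \<open>
  The \<open>i\<close>-th coordinate of the operator \<open>\<A>\<^sub>T\<close>; here \<open>T\<close> is one of \<^const>\<open>qR\<close>, \<^const>\<open>qI\<close>, \<^const>\<open>qJ\<close>, \<^const>\<open>qK\<close>.
\<close>

definition opA :: "(quat \<Rightarrow> real) \<Rightarrow> (nat \<Rightarrow> quat^'n^'n) \<Rightarrow> real^'n^'n \<Rightarrow> nat \<Rightarrow> real" where
  "opA T A S i = rinner (map_matrix T (A i)) S"

definition real_constraints ::
  "nat \<Rightarrow> (nat \<Rightarrow> quat^'n^'n) \<Rightarrow> (nat \<Rightarrow> quat) \<Rightarrow>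
   real^'n^'n \<Rightarrow> real^'n^'n \<Rightarrow> real^'n^'n \<Rightarrow> real^'n^'n \<Rightarrow> bool" where
  "real_constraints m A b R I J K \<longleftrightarrow> (\<forall>i\<in>{1..m}.
     opA qR A R i + opA qI A I i + opA qJ A J i + opA qK A K i = qR (b i) \<and>
     opA qR A I i - opA qI A R i - opA qJ A K i + opA qK A J i = qI (b i) \<and>
     opA qR A J i + opA qI A K i - opA qJ A R i - opA qK A I i = qJ (b i) \<and>
     opA qR A K i - opA qI A J i + opA qJ A I i - opA qK A R i = qK (b i))"

definition real_objective ::
  "quat^'n^'n \<Rightarrow> real^'n^'n \<Rightarrow> real^'n^'n \<Rightarrow> real^'n^'n \<Rightarrow> real^'n^'n \<Rightarrow> real" where
  "real_objective C R I J K =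
     rinner (map_matrix qR C) R + rinner (map_matrix qI C) I +
     rinner (map_matrix qJ C) J + rinner (map_matrix qK C) K"

definition feasible_R ::
  "nat \<Rightarrow> (nat \<Rightarrow> quat^'n^'n) \<Rightarrow> (nat \<Rightarrow> quat) \<Rightarrow> (real^(4 \<times> 'n)^(4 \<times> 'n)) set" where
  "feasible_R m A b = {Y. symmetric Y \<and> rpsd Y \<and>
     (\<exists>R I J K. Y = Lam R I J K \<and> real_constraints m A b R I J K)}"

text \<open>If \<open>Y = \<Lambda>(H)\<close>, then the components of \<open>H\<close> form the first block column of \<open>Y\<close>.\<close>

definition objective_R :: "quat^'n^'n \<Rightarrow> real^(4 \<times> 'n)^(4 \<times> 'n) \<Rightarrow> real" where
  "objective_R C Y = real_objective C (block Y 1 1) (block Y 2 1) (block Y 3 1) (block Y 4 1)"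

lemma objective_R_Lam: "objective_R C (Lam R I J K) = real_objective C R I J K"
  by (simp add: objective_R_def block_Lam)

definition feasible_R' ::
  "nat \<Rightarrow> (nat \<Rightarrow> quat^'n^'n) \<Rightarrow> (nat \<Rightarrow> quat) \<Rightarrow> (real^(4 \<times> 'n)^(4 \<times> 'n)) set" where
  "feasible_R' m A b = {X. symmetric X \<and> rpsd X \<and>
     real_constraints m A b (RX X) (IX X) (JX X) (KX X)}"

definition objective_R' :: "quat^'n^'n \<Rightarrow> real^(4 \<times> 'n)^(4 \<times> 'n) \<Rightarrow> real" where
  "objective_R' C X = real_objective C (RX X) (IX X) (JX X) (KX X)"

end

theory Submission
  imports Defs
begin

text \<open>
  Identify real \<open>4n\<close>-vectors with quaternionic \<open>n\<close>-vectors. Then \<^term>\<open>Lam\<close> is the real matrix of left multiplication by \<open>H\<close>,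
  so the real part of \<open>v\<^sup>* H v\<close> is the quadratic form of \<open>\<Lambda>(H)\<close>, and \<open>H\<close> is positive semidefinite
  iff \<open>\<Lambda>(H)\<close> is. Right multiplication by a unit \<open>u\<close> is an orthogonal map \<open>P\<^sub>u\<close>, and
  \<open>X \<mapsto> \<Lambda>(R\<^sub>X + I\<^sub>X \<^bold>i + J\<^sub>X \<^bold>j + K\<^sub>X \<^bold>k)\<close> is the map \<open>X \<mapsto> \<Sum>\<^sub>u P\<^sub>u\<^sup>T X P\<^sub>u\<close> over
  \<open>u \<in> {1, \<^bold>i, \<^bold>j, \<^bold>k}\<close>, which preserves positive semidefiniteness. Conversely \<open>X = \<Lambda>(H) / 4\<close> is mapped
  to \<open>\<Lambda>(H)\<close>. Hence all three programs attain the same objective values.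
\<close>

section \<open>Quaternion components and conjugation\<close>

lemma qcnj_simps [simp]:
  "qR (qcnj x) = qR x" "qI (qcnj x) = - qI x" "qJ (qcnj x) = - qJ x" "qK (qcnj x) = - qK x"
  by (simp_all add: qcnj_def)

lemma quat_component_sum:
  "qR (sum f S) = (\<Sum>x\<in>S. qR (f x))" "qI (sum f S) = (\<Sum>x\<in>S. qI (f x))"
  "qJ (sum f S) = (\<Sum>x\<in>S. qJ (f x))" "qK (sum f S) = (\<Sum>x\<in>S. qK (f x))"
  by (induction S rule: infinite_finite_induct; simp add: quat_defs)+

lemma quat_component_mult:
  "qR (x * y) = qR x * qR y - qI x * qI y - qJ x * qJ y - qK x * qK y"
  "qI (x * y) = qR x * qI y + qI x * qR y + qJ x * qK y - qK x * qJ y"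
  "qJ (x * y) = qR x * qJ y - qI x * qK y + qJ x * qR y + qK x * qI y"
  "qK (x * y) = qR x * qK y + qI x * qJ y - qJ x * qI y + qK x * qR y"
  by (simp_all add: times_quat_def)

lemma qcnj_mult: "qcnj (x * y) = qcnj y * qcnj x"
  by (simp add: quat_eq_iff quat_component_mult algebra_simps)

lemma qcnj_qcnj [simp]: "qcnj (qcnj x) = x"
  by (simp add: quat_eq_iff)

lemma qcnj_sum: "qcnj (sum f S) = (\<Sum>x\<in>S. qcnj (f x))"
  by (simp add: quat_eq_iff quat_component_sum sum_negf)

lemma qcnj_fixed_imp_real:
  assumes "qcnj x = x"
  shows "x = of_real (qR x)"
  using assms by (simp add: quat_eq_iff of_real_def quat_defs)

lemma qR_of_real [simp]: "qR (of_real r) = r"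
  by (simp add: of_real_def quat_defs)

section \<open>Inner products, constraints and objectives in real coordinates\<close>

lemma qinner_eq: "qinner A B = (\<Sum>i\<in>UNIV. \<Sum>j\<in>UNIV. qcnj (A $ j $ i) * B $ j $ i)"
  by (simp add: qinner_def trace_def matrix_matrix_mult_def ctranspose_def transpose_def
      map_matrix_def)

lemma rinner_eq: "rinner A B = (\<Sum>i\<in>UNIV. \<Sum>j\<in>UNIV. A $ j $ i * B $ j $ i)"
  by (simp add: rinner_def trace_def matrix_matrix_mult_def transpose_def)

text \<open>Expanding \<open>qcnj a * h\<close> in the units produces exactly the sign pattern of
  the four real constraint equations, and its real part gives the real objective.\<close>

lemma qinner_components:
  fixes A :: "quat^'n^'n"
  defines "a \<equiv> \<lambda>T. map_matrix T A"
  shows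
  "qR (qinner A (quat_mat R I J K)) =
     rinner (a qR) R + rinner (a qI) I + rinner (a qJ) J + rinner (a qK) K"
  "qI (qinner A (quat_mat R I J K)) =
     rinner (a qR) I - rinner (a qI) R - rinner (a qJ) K + rinner (a qK) J"
  "qJ (qinner A (quat_mat R I J K)) =
     rinner (a qR) J + rinner (a qI) K - rinner (a qJ) R - rinner (a qK) I"
  "qK (qinner A (quat_mat R I J K)) =
     rinner (a qR) K - rinner (a qI) J + rinner (a qJ) I - rinner (a qK) R"
  by (simp_all add: a_def qinner_eq rinner_eq quat_component_sum quat_component_mult quat_mat_def
      map_matrix_def sum.distrib sum_subtractf sum_negf algebra_simps)

lemma real_constraints_iff:
  "real_constraints m A b R I J K \<longleftrightarrow> (\<forall>i\<in>{1..m}. qinner (A i) (quat_mat R I J K) = b i)"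
  by (simp add: real_constraints_def opA_def quat_eq_iff qinner_components)

lemma real_objective_eq: "real_objective C R I J K = objective_H C (quat_mat R I J K)"
  by (simp add: real_objective_def objective_H_def qinner_components)

section \<open>Hermitian matrices and symmetry of \<open>Lam\<close>\<close>

lemma symmetric_iff: "symmetric X \<longleftrightarrow> (\<forall>p q. X $ p $ q = X $ q $ p)"
  by (simp add: symmetric_def transpose_def vec_eq_iff)

lemma transpose_Lam:
  "transpose (Lam R I J K) =
     Lam (transpose R) (- transpose I) (- transpose J) (- transpose K)"
  by (simp add: vec_eq_iff forall_index_4 Lam_def from_blocks_def transpose_def)

lemma Lam_eq_iff: "Lam R I J K = Lam R' I' J' K' \<longleftrightarrow> R = R' \<and> I = I' \<and> J = J' \<and> K = K'"
  by (metis block_Lam)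

lemma symmetric_Lam_iff:
  "symmetric (Lam R I J K) \<longleftrightarrow>
     R = transpose R \<and> I = - transpose I \<and> J = - transpose J \<and> K = - transpose K"
  unfolding symmetric_def transpose_Lam Lam_eq_iff ..

lemma ctranspose_quat_mat:
  "ctranspose (quat_mat R I J K) =
     quat_mat (transpose R) (- transpose I) (- transpose J) (- transpose K)"
  by (simp add: vec_eq_iff ctranspose_def quat_mat_def transpose_def map_matrix_def qcnj_def)

lemma quat_mat_eq_iff:
  "quat_mat R I J K = quat_mat R' I' J' K' \<longleftrightarrow> R = R' \<and> I = I' \<and> J = J' \<and> K = K'"
  by (auto simp: vec_eq_iff quat_mat_def)

text \<open>Both conditions say that \<open>R\<close> is symmetric and \<open>I\<close>,
  \<open>J\<close>, \<open>K\<close> are skew-symmetric.\<close>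

lemma hermitian_quat_mat_iff:
  "hermitian (quat_mat R I J K) \<longleftrightarrow> symmetric (Lam R I J K)"
  unfolding hermitian_def ctranspose_quat_mat quat_mat_eq_iff symmetric_Lam_iff ..

section \<open>Quadratic forms and positive semidefiniteness\<close>

lemma quadratic_form_blocks:
  fixes X :: "real^(4 \<times> 'n::finite)^(4 \<times> 'n)"
  shows "v \<bullet> (X *v v) = (\<Sum>i\<in>UNIV. \<Sum>j\<in>UNIV. \<Sum>k\<in>UNIV. \<Sum>l\<in>UNIV.
           v $ (k, i) * X $ (k, i) $ (l, j) * v $ (l, j))"
proof -
  have "v \<bullet> (X *v v) = (\<Sum>(k, i)\<in>UNIV \<times> UNIV. \<Sum>(l, j)\<in>UNIV \<times> UNIV.
           v $ (k, i) * X $ (k, i) $ (l, j) * v $ (l, j))"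
    by (simp add: inner_vec_def matrix_vector_mult_def sum_distrib_left mult.assoc
        case_prod_unfold)
  also have "\<dots> = (\<Sum>k\<in>UNIV. \<Sum>i\<in>UNIV. \<Sum>l\<in>UNIV. \<Sum>j\<in>UNIV.
           v $ (k, i) * X $ (k, i) $ (l, j) * v $ (l, j))"
    by (simp only: sum.cartesian_product [symmetric] prod.case)
  also have "\<dots> = (\<Sum>i\<in>UNIV. \<Sum>k\<in>UNIV. \<Sum>j\<in>UNIV. \<Sum>l\<in>UNIV.
           v $ (k, i) * X $ (k, i) $ (l, j) * v $ (l, j))"
    by (subst sum.swap) (intro sum.cong refl sum.swap)
  also have "\<dots> = (\<Sum>i\<in>UNIV. \<Sum>j\<in>UNIV. \<Sum>k\<in>UNIV. \<Sum>l\<in>UNIV.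
           v $ (k, i) * X $ (k, i) $ (l, j) * v $ (l, j))"
    by (intro sum.cong refl sum.swap)
  finally show ?thesis .
qed

definition realify :: "quat^'n \<Rightarrow> real^(4 \<times> 'n)" where
  "realify v = (\<chi> p. vector [qR (v $ snd p), qI (v $ snd p), qJ (v $ snd p), qK (v $ snd p)] $ fst p)"

definition quatify :: "real^(4 \<times> 'n) \<Rightarrow> quat^'n" where
  "quatify x = (\<chi> i. Quat (x $ (1, i)) (x $ (2, i)) (x $ (3, i)) (x $ (4, i)))"

lemma realify_component:
  "realify v $ (1, i) = qR (v $ i)" "realify v $ (2, i) = qI (v $ i)"
  "realify v $ (3, i) = qJ (v $ i)" "realify v $ (4, i) = qK (v $ i)"
  by (simp_all add: realify_def)

lemma realify_quatify [simp]: "realify (quatify x) = x"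
  by (simp add: vec_eq_iff forall_index_4 realify_component quatify_def)

text \<open>The real part of \<open>qcnj a * b\<close> is the Euclidean inner product of coordinate
  vectors. With the entry indices \<open>i\<close>, \<open>j\<close> outermost, the two sides agree
  term by term, each term being a sum over the 16 block positions.\<close>

lemma qR_quadratic_form:
  "qR (\<Sum>i\<in>UNIV. qcnj (v $ i) * (quat_mat R I J K *v v) $ i) =
     realify v \<bullet> (Lam R I J K *v realify v)"
  unfolding quadratic_form_blocks
  unfolding matrix_vector_mult_def vec_lambda_beta sum_distrib_left
    quat_component_sum
  by (intro sum.cong refl)
     (simp add: sum_4 realify_component Lam_def from_blocks_def quat_component_mult quat_mat_def
      algebra_simps)

text \<open>Conjugation reverses products and turns \<open>H\<close> into its conjugate transpose,
  which is \<open>H\<close> again; only the two summation indices trade places.\<close>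

lemma hermitian_form_real:
  assumes "hermitian H"
  shows "qcnj (\<Sum>i\<in>UNIV. qcnj (v $ i) * (H *v v) $ i) = (\<Sum>i\<in>UNIV. qcnj (v $ i) * (H *v v) $ i)"
proof -
  have H: "qcnj (H $ i $ j) = H $ j $ i" for i j
    using arg_cong [OF assms [unfolded hermitian_def], of "\<lambda>Z. Z $ j $ i"]
    by (simp add: ctranspose_def transpose_def map_matrix_def)
  have "qcnj (\<Sum>i\<in>UNIV. qcnj (v $ i) * (H *v v) $ i) =
          (\<Sum>i\<in>UNIV. \<Sum>j\<in>UNIV. qcnj (v $ j) * H $ j $ i * v $ i)"
    by (simp add: matrix_vector_mult_def sum_distrib_left sum_distrib_right qcnj_sum qcnj_mult H)
  also have "\<dots> = (\<Sum>j\<in>UNIV. \<Sum>i\<in>UNIV. qcnj (v $ j) * H $ j $ i * v $ i)"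
    by (rule sum.swap)
  also have "\<dots> = (\<Sum>i\<in>UNIV. qcnj (v $ i) * (H *v v) $ i)"
    by (simp add: matrix_vector_mult_def sum_distrib_left mult.assoc)
  finally show ?thesis .
qed

lemma qpsd_quat_mat_iff:
  fixes R I J K :: "real^'n^'n"
  shows "qpsd (quat_mat R I J K) \<longleftrightarrow> rpsd (Lam R I J K)"
proof -
  let ?H = "quat_mat R I J K" and ?L = "Lam R I J K"
  let ?q = "\<lambda>v. \<Sum>i\<in>UNIV. qcnj (v $ i) * (?H *v v) $ i"
  have "(\<forall>v. \<exists>r\<ge>0. ?q v = of_real r) \<longleftrightarrow> (\<forall>x. x \<bullet> (?L *v x) \<ge> 0)" if "hermitian ?H"
  proof -
    \<comment> \<open>A self-conjugate quaternion equals its real part, so only the sign of that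
      part is at stake.\<close>
    have "(\<exists>r\<ge>0. ?q v = of_real r) \<longleftrightarrow> 0 \<le> realify v \<bullet> (?L *v realify v)" for v
      unfolding qR_quadratic_form [symmetric]
      using qcnj_fixed_imp_real [OF hermitian_form_real [OF that, of v]] by force
    \<comment> \<open>Surjectivity of \<open>realify\<close>: testing on quaternionic vectors
      reaches every real vector.\<close>
    moreover have "(\<forall>x. P x) \<longleftrightarrow> (\<forall>v. P (realify v))" for P :: "real^(4 \<times> 'n) \<Rightarrow> bool"
      by (metis realify_quatify)
    ultimately show ?thesis
      by simp
  qed
  then show ?thesis
    by (auto simp: qpsd_def rpsd_def hermitian_quat_mat_iff)
qed

lemma feasible_H_quat_mat_iff:
  "quat_mat R I J K \<in> feasible_H m A b \<longleftrightarrow> rpsd (Lam R I J K) \<and> real_constraints m A b R I J K"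
  by (auto simp: feasible_H_def real_constraints_iff qpsd_quat_mat_iff hermitian_quat_mat_iff
      rpsd_def)

lemma feasible_R_eq:
  "feasible_R m A b = {Lam R I J K | R I J K. quat_mat R I J K \<in> feasible_H m A b}"
  by (auto simp: feasible_R_def feasible_H_quat_mat_iff rpsd_def)

section \<open>Averaging a real matrix into the form \<open>Lam\<close>\<close>

abbreviation QX :: "real^(4 \<times> 'n::finite)^(4 \<times> 'n) \<Rightarrow> quat^'n^'n" where
  "QX X \<equiv> quat_mat (RX X) (IX X) (JX X) (KX X)"

lemma rpsd_Lam_average:
  fixes X :: "real^(4 \<times> 'n::finite)^(4 \<times> 'n)"
  assumes "rpsd X"
  shows "rpsd (Lam (RX X) (IX X) (JX X) (KX X))"
proof -
  have sym: "X $ p $ q = X $ q $ p" for p q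
    using assms unfolding rpsd_def symmetric_iff by blast
  have "symmetric (Lam (RX X) (IX X) (JX X) (KX X))"
    \<comment> \<open>The differences \<open>M - transpose M\<close> make the last three parts skew;
      symmetry of \<open>RX X\<close> comes from the diagonal blocks of \<open>X\<close>.\<close>
    by (simp add: symmetric_Lam_iff vec_eq_iff RX_def IX_def JX_def KX_def block_def transpose_def
        sym [of "(k, j)" "(k, i)" for i j k])
  moreover have "x \<bullet> (Lam (RX X) (IX X) (JX X) (KX X) *v x) \<ge> 0" for x
  proof -
    \<comment> \<open>Right multiplication by \<open>u\<close> in real coordinates. Right
      multiplications commute with left ones, so summing the four conjugates of \<open>X\<close>
      lands in the matrices of left multiplications.\<close>
    define P where "P u = realify (\<chi> i. quatify x $ i * u)" for u
    have "x \<bullet> (Lam (RX X) (IX X) (JX X) (KX X) *v x) =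
            P 1 \<bullet> (X *v P 1) + P qi \<bullet> (X *v P qi) + P qj \<bullet> (X *v P qj) + P qk \<bullet> (X *v P qk)"
      unfolding quadratic_form_blocks sum.distrib [symmetric]
    proof (rule sum.cong [OF refl], rule sum.cong [OF refl])
      fix i j
      \<comment> \<open>Transposed blocks contribute entries with \<open>i\<close> and
        \<open>j\<close> exchanged; symmetry of \<open>X\<close> moves \<open>i\<close> back to the
        row and \<open>j\<close> to the column, as in the right-hand sum. A polynomial identity
        remains.\<close>
      have *: "X $ (2, j) $ (1, i) = X $ (1, i) $ (2, j)" "X $ (3, j) $ (1, i) = X $ (1, i) $ (3, j)"
        "X $ (4, j) $ (1, i) = X $ (1, i) $ (4, j)" "X $ (3, j) $ (2, i) = X $ (2, i) $ (3, j)"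
        "X $ (4, j) $ (2, i) = X $ (2, i) $ (4, j)" "X $ (4, j) $ (3, i) = X $ (3, i) $ (4, j)"
        by (rule sym)+
      show "(\<Sum>k\<in>UNIV. \<Sum>l\<in>UNIV.
          x $ (k, i) * Lam (RX X) (IX X) (JX X) (KX X) $ (k, i) $ (l, j) * x $ (l, j)) =
        (\<Sum>k\<in>UNIV. \<Sum>l\<in>UNIV.
          P 1 $ (k, i) * X $ (k, i) $ (l, j) * P 1 $ (l, j) +
          P qi $ (k, i) * X $ (k, i) $ (l, j) * P qi $ (l, j) +
          P qj $ (k, i) * X $ (k, i) $ (l, j) * P qj $ (l, j) +
          P qk $ (k, i) * X $ (k, i) $ (l, j) * P qk $ (l, j))"
        by (simp add: sum_4 P_def realify_component quatify_def quat_component_mult one_quat_def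
            qi_def qj_def qk_def Lam_def from_blocks_def RX_def IX_def JX_def KX_def block_def
            transpose_def * algebra_simps)
    qed
    then show ?thesis
      using assms by (simp add: rpsd_def)
  qed
  ultimately show ?thesis
    by (simp add: rpsd_def)
qed

lemma QX_feasible:
  assumes "X \<in> feasible_R' m A b"
  shows "QX X \<in> feasible_H m A b"
  using assms rpsd_Lam_average by (auto simp: feasible_R'_def feasible_H_quat_mat_iff)

lemma objective_R'_eq: "objective_R' C X = objective_H C (QX X)"
  by (simp add: objective_R'_def real_objective_eq)

text \<open>The factor \<open>1/4\<close> undoes a fourfold count: \<open>R\<close> fills four
  diagonal blocks, and each skew part appears in two blocks below the diagonal, each counted again
  through its negated transpose.\<close>

lemma average_Lam:
  fixes R I J K :: "real^'n^'n"
  assumes "symmetric (Lam R I J K)"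
  defines "X \<equiv> (1/4) *\<^sub>R Lam R I J K"
  shows "RX X = R" "IX X = I" "JX X = J" "KX X = K"
proof -
  have "RX X $ i $ j = R $ i $ j \<and> IX X $ i $ j = I $ i $ j \<and>
      JX X $ i $ j = J $ i $ j \<and> KX X $ i $ j = K $ i $ j" for i j
  proof -
    have "M $ j $ i = - M $ i $ j" if "M = - transpose M" for M :: "real^'n^'n"
      using arg_cong [OF that, of "\<lambda>Z. Z $ j $ i"] by (simp add: transpose_def)
    then have "I $ j $ i = - I $ i $ j" "J $ j $ i = - J $ i $ j" "K $ j $ i = - K $ i $ j"
      using assms(1) unfolding symmetric_Lam_iff by blast+
    then show ?thesis
      by (simp add: X_def RX_def IX_def JX_def KX_def block_def Lam_def from_blocks_def
          transpose_def)
  qed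
  then show "RX X = R" "IX X = I" "JX X = J" "KX X = K"
    by (simp_all add: vec_eq_iff)
qed

lemma rpsd_scaleR:
  assumes "rpsd Y" "c \<ge> 0"
  shows "rpsd (c *\<^sub>R Y)"
  using assms by (auto simp: rpsd_def symmetric_iff scaleR_matrix_vector_assoc [symmetric])

section \<open>Transfer between the three programs\<close>

lemma QX_surj_feasible:
  assumes "H \<in> feasible_H m A b"
  obtains X where "X \<in> feasible_R' m A b" "QX X = H"
proof -
  define R I J K where
    "R = map_matrix qR H" "I = map_matrix qI H" "J = map_matrix qJ H" "K = map_matrix qK H"
  have H: "quat_mat R I J K = H"
    by (simp add: R_I_J_K_def)
  define X where "X = (1/4) *\<^sub>R Lam R I J K"
  have L: "rpsd (Lam R I J K)" "real_constraints m A b R I J K"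
    using assms by (simp_all add: feasible_H_quat_mat_iff flip: H)
  then have comps: "RX X = R" "IX X = I" "JX X = J" "KX X = K"
    using average_Lam unfolding X_def rpsd_def by blast+
  have "rpsd X"
    using L(1) by (simp add: X_def rpsd_scaleR)
  then have "X \<in> feasible_R' m A b"
    using L(2) by (simp add: feasible_R'_def comps rpsd_def)
  then show thesis
    using that H comps by simp
qed

text \<open>As \<open>objective_R'\<close> is \<open>objective_H\<close> composed with
  \<open>QX\<close>, this set equality carries over both suprema and optimal solutions.\<close>

lemma QX_image_feasible: "QX ` feasible_R' m A b = feasible_H m A b"
  by (auto intro: QX_feasible elim: QX_surj_feasible)

lemma optimal_value_R'_eq_H:
  "optimal_value (feasible_R' m A b) (objective_R' C) =
     optimal_value (feasible_H m A b) (objective_H C)"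
  by (simp add: optimal_value_def objective_R'_eq image_image flip: QX_image_feasible)

lemma optimal_value_R_eq_H:
  "optimal_value (feasible_R m A b) (objective_R C) =
     optimal_value (feasible_H m A b) (objective_H C)"
proof -
  \<comment> \<open>The suprema agree because the sets of attained values do, \<open>H\<close> and
    \<open>Lam\<close> of its components giving the same value.\<close>
  have "objective_R C ` feasible_R m A b = objective_H C ` feasible_H m A b"
  proof (intro equalityI subsetI)
    fix y assume "y \<in> objective_R C ` feasible_R m A b"
    then show "y \<in> objective_H C ` feasible_H m A b"
      by (auto simp: feasible_R_eq objective_R_Lam real_objective_eq)
  next
    fix y assume "y \<in> objective_H C ` feasible_H m A b"
    then obtain H where H: "H \<in> feasible_H m A b" "y = objective_H C H"
      by blast
    let ?L = "Lam (map_matrix qR H) (map_matrix qI H) (map_matrix qJ H) (map_matrix qK H)"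
    have "?L \<in> feasible_R m A b"
      using H(1) by (auto simp: feasible_R_eq intro!: exI)
    moreover have "objective_R C ?L = y"
      by (simp add: objective_R_Lam real_objective_eq H(2))
    ultimately show "y \<in> objective_R C ` feasible_R m A b"
      by blast
  qed
  from arg_cong [OF this, of "image ereal"] show ?thesis
    by (simp add: optimal_value_def image_image)
qed

theorem theorem3p2:
  fixes C :: "quat^'n^'n" and m :: nat and A :: "nat \<Rightarrow> quat^'n^'n" and b :: "nat \<Rightarrow> quat"
  assumes "hermitian C"
  shows "optimal_value (feasible_R' m A b) (objective_R' C) =
           optimal_value (feasible_R m A b) (objective_R C) \<and>
         (\<forall>X. optimal_solution (feasible_R' m A b) (objective_R' C) X \<longrightarrow>
           optimal_solution (feasible_H m A b) (objective_H C)
             (quat_mat (RX X) (IX X) (JX X) (KX X)))"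
  \<comment> \<open>For optimality, every competitor of \<open>QX X\<close> is \<open>QX\<close> of
    some point feasible for the averaged program, where \<open>X\<close> is already maximal.\<close>
  by (auto simp: optimal_value_R'_eq_H optimal_value_R_eq_H optimal_solution_def objective_R'_eq
      simp flip: QX_image_feasible)

end
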